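(* Let $\mathcal{A}=(Q,\Sigma,\delta)$ be a synchronizing DFA with $n$ states. Then $\mathcal{A}$ has a unique strongly connected sink component with state set $S$. Let $w$ be a word and $r=|Q.w|$. Let $d$ be the smallest positive integer with $d<n$ such that $\Sigma^{\le d}$ is complete for $V_S$ with respect to every stochastic vector $g\in V_S$ and such that for each $q\in Q$ there is a word $u_q\in\Sigma^{\le d}$ with $q.u_q\in S\cap Q.w$ (assume such $d$ exists). Then $\mathrm{rt}(\mathcal{A})\le (|w|+d)\frac{r^3-r}{6}-d$ if $r\ge 4$, and $\mathrm{rt}(\mathcal{A})\le |w|+(|w|+d)(r-1)^2$ if $r\le 3$. Moreover, every pair of states of $Q$ can be compressed (mapped to a single state) by a word of length at most $|w|+(|w|+d)\frac{r^2-r}{2}$.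
   Context: A DFA $\mathcal{A}=(Q,\Sigma,\delta)$ has finite state set $Q=\{1,\dots,n\}$, finite alphabet $\Sigma$ and total transition function, extended to words; $q.w=\delta(q,w)$, $T.w=\{q.w\mid q\in T\}$. $\Sigma^{\le c}$ is the set of words of length at most $c$. It is synchronizing if some word $w$ satisfies $|Q.w|=1$; $\mathrm{rt}(\mathcal{A})$ is the minimum length of such a word. A sink component is a strongly connected set of states closed under all transitions. Vectors are row vectors; $[q]$ is the standard basis vector of state $q$, $[w]$ is the 0-1 matrix with $[w]_{p,q}=1$ iff $p.w=q$; $V_S=\langle [p]\mid p\in S\rangle$; a stochastic vector is non-negative with entries summing to $1$. A set of words $W$ is complete for a subspace $V$ with respect to $g\in V$ if $\langle g[w]\mid w\in W\rangle=V$. *)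

theory Defs
  imports "HOL-Analysis.Analysis"
begin

text \<open>A DFA with state type 'q (finite, Q = UNIV) and alphabet type 'a (finite),
  total transition function delta.  Words are lists.\<close>

definition tr :: "('q \<Rightarrow> 'a \<Rightarrow> 'q) \<Rightarrow> 'q \<Rightarrow> 'a list \<Rightarrow> 'q" where
  "tr \<delta> q w = foldl \<delta> q w"

definition trs :: "('q \<Rightarrow> 'a \<Rightarrow> 'q) \<Rightarrow> 'q set \<Rightarrow> 'a list \<Rightarrow> 'q set" where
  "trs \<delta> T w = (\<lambda>q. tr \<delta> q w) ` T"

definition synchronizing :: "('q \<Rightarrow> 'a \<Rightarrow> 'q) \<Rightarrow> bool" where
  "synchronizing \<delta> \<longleftrightarrow> (\<exists>w. card (trs \<delta> UNIV w) = 1)"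

definition reset_threshold :: "('q \<Rightarrow> 'a \<Rightarrow> 'q) \<Rightarrow> nat" where
  "reset_threshold \<delta> = (LEAST k. \<exists>w. length w = k \<and> card (trs \<delta> UNIV w) = 1)"

definition sink_component :: "('q \<Rightarrow> 'a \<Rightarrow> 'q) \<Rightarrow> 'q set \<Rightarrow> bool" where
  "sink_component \<delta> S \<longleftrightarrow> S \<noteq> {} \<and>
     (\<forall>p\<in>S. \<forall>q\<in>S. \<exists>w. tr \<delta> p w = q) \<and>
     (\<forall>q\<in>S. \<forall>a. \<delta> q a \<in> S)"

text \<open>Row vectors indexed by states; [q] = axis q 1; g[w] the row vector g times matrix [w].\<close>

definition vec_word :: "('q::finite \<Rightarrow> 'a \<Rightarrow> 'q) \<Rightarrow> real^'q \<Rightarrow> 'a list \<Rightarrow> real^'q" where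
  "vec_word \<delta> g w = (\<chi> q. \<Sum>p\<in>{p. tr \<delta> p w = q}. g $ p)"

definition V_sub :: "('q::finite) set \<Rightarrow> (real^'q) set" where
  "V_sub S = span ((\<lambda>p. axis p 1) ` S)"

definition stochastic :: "real^('q::finite) \<Rightarrow> bool" where
  "stochastic g \<longleftrightarrow> (\<forall>q. g $ q \<ge> 0) \<and> (\<Sum>q\<in>UNIV. g $ q) = 1"

definition words_upto :: "nat \<Rightarrow> ('a::finite) list set" where
  "words_upto c = {w. length w \<le> c}"

definition complete_for :: "('q::finite \<Rightarrow> 'a \<Rightarrow> 'q) \<Rightarrow> 'a list set \<Rightarrow> (real^'q) set \<Rightarrow> real^'q \<Rightarrow> bool" where
  "complete_for \<delta> W V g \<longleftrightarrow> span ((\<lambda>w. vec_word \<delta> g w) ` W) = V"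

definition good_d :: "('q::finite \<Rightarrow> 'a::finite \<Rightarrow> 'q) \<Rightarrow> 'q set \<Rightarrow> 'a list \<Rightarrow> nat \<Rightarrow> bool" where
  "good_d \<delta> S w d \<longleftrightarrow>
     (\<forall>g. g \<in> V_sub S \<and> stochastic g \<longrightarrow> complete_for \<delta> (words_upto d) (V_sub S) g) \<and>
     (\<forall>q. \<exists>u \<in> words_upto d. tr \<delta> q u \<in> S \<inter> trs \<delta> UNIV w)"

end

theory Submission
  imports Defs "HOL-Computational_Algebra.Polynomial"
begin

text \<open>
  Let \<open>R = Q.w\<close>. The words \<open>uw\<close> with \<open>|u| \<le> d\<close> act on \<open>R\<close> as the letters of a smaller automaton, and
  a word of length \<open>m\<close> in these letters costs at most \<open>(|w| + d) m\<close>. This automaton is synchronizing: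
  take an image \<open>T = S.v\<^sub>0\<close> of minimal rank \<open>k\<close> among its words and the uniform distribution \<open>g\<close> on \<open>T\<close>.
  By minimality every \<open>g[uw]\<close> puts weight exactly \<open>1/k\<close> on each class of the kernel of \<open>v\<^sub>0\<close>, so all
  \<open>g[u]\<close> are orthogonal to the indicator vector of the \<open>w\<close>-preimage of a class minus \<open>1/k\<close>; completeness forces
  this vector to vanish on \<open>S\<close>, so \<open>k = 1\<close>.

  For an automaton with \<open>r\<close> states the Frankl--Pin argument compresses a \<open>k\<close>-subset by a word of
  length at most \<open>(r - k + 2 choose 2)\<close>. Summation gives a reset word of length \<open>(r\<^sup>3 - r)/6\<close>, and for
  \<open>r \<ge> 4\<close> one letter is saved because rank \<open>r - 3\<close> is reached within 9 letters instead of \<open>1 + 3 + 6\<close>.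
\<close>

section \<open>Skew Bollobas inequality for pairs\<close>

text \<open>These pairs index the symmetrised monomials in two variables, so the count bounds the
  dimension used in the skew Bollobas inequality.\<close>

lemma card_ordered_pairs_upto: "card {(a, b). a \<le> b \<and> b \<le> s} = (s + 2) choose 2"
proof -
  have "{(a, b). a \<le> b \<and> b \<le> s} = (\<lambda>(b, a). (a, b)) ` (SIGMA b:{..s}. {..b})"
    by auto
  then have "card {(a, b). a \<le> b \<and> b \<le> s} = card (SIGMA b:{..s}. {..b})"
    by (simp add: card_image inj_on_def)
  also have "\<dots> = (\<Sum>b\<le>s. Suc b)"
    by simp
  also have "\<dots> = (s + 2) choose 2"
    by (induction s) (simp_all add: numeral_2_eq_2)
  finally show ?thesis .
qed

text \<open>All \<open>D\<close> share the monomials up to degree \<open>s\<close>; coefficients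
  above the actual degree are zero.\<close>

lemma prod_differences_expansion:
  fixes t :: "'q \<Rightarrow> real"
  assumes "finite D" "card D \<le> s"
  shows "\<exists>c. \<forall>x. (\<Prod>d\<in>D. x - t d) = (\<Sum>a\<le>s. c a * x ^ a)"
proof -
  define P where "P = (\<Prod>d\<in>D. [:- t d, 1:])"
  have "degree P \<le> (\<Sum>d\<in>D. degree [:- t d, 1:])"
    unfolding P_def using degree_prod_sum_le[OF assms(1), of "\<lambda>d. [:- t d, 1:]"] by (simp add: o_def)
  then have deg: "degree P \<le> s"
    using assms(2) by simp
  have "(\<Prod>d\<in>D. x - t d) = (\<Sum>a\<le>s. coeff P a * x ^ a)" for x
  proof -
    have "(\<Prod>d\<in>D. x - t d) = poly P x"
      by (simp add: P_def poly_prod)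
    also have "\<dots> = (\<Sum>a\<le>degree P. coeff P a * x ^ a)"
      by (rule poly_altdef)
    also have "\<dots> = (\<Sum>a\<le>s. coeff P a * x ^ a)"
      using deg by (intro sum.mono_neutral_left) (auto simp: coeff_eq_0)
    finally show ?thesis .
  qed
  then show ?thesis by blast
qed

text \<open>The points \<open>p\<close> and \<open>q\<close> of a triple may coincide. The proof attaches to \<open>D\<close> the symmetric
  polynomial \<open>h\<^sub>D(x) h\<^sub>D(y)\<close> with \<open>h\<^sub>D\<close> vanishing exactly on \<open>D\<close>; these are linearly independent in
  the space of symmetric polynomials of degree at most \<open>s\<close> in each variable.\<close>

lemma skew_bollobas_pairs:
  fixes L :: "('q::finite set \<times> 'q \<times> 'q) list"
  assumes avoid: "\<And>D p q. (D, p, q) \<in> set L \<Longrightarrow> card D \<le> s \<and> p \<notin> D \<and> q \<notin> D"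
    and meet: "sorted_wrt (\<lambda>(D, _) (_, p, q). p \<in> D \<or> q \<in> D) L"
  shows "length L \<le> (s + 2) choose 2"
proof -
  obtain t0 :: "'q \<Rightarrow> nat" where "inj t0"
    using finite_imp_inj_to_nat_seg[of "UNIV :: 'q set"] by auto
  define t where "t x = real (t0 x)" for x
  have t: "t x = t y \<longleftrightarrow> x = y" for x y
    using \<open>inj t0\<close> by (auto simp: t_def inj_def)
  define h where "h D x = (\<Prod>d\<in>D. t x - t d)" for D :: "'q set" and x
  have h0: "h D x = 0 \<longleftrightarrow> x \<in> D" for D x
    by (auto simp: h_def t)
  \<comment> \<open>Polynomials enter only through their values at pairs of states, recorded as
    matrices.\<close>
  define F :: "'q set \<times> 'q \<times> 'q \<Rightarrow> real^'q^'q"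
    where "F T = (\<chi> x y. h (fst T) x * h (fst T) y)" for T
  define M :: "nat \<Rightarrow> nat \<Rightarrow> real^'q^'q"
    where "M a b = (\<chi> x y. t x ^ a * t y ^ b + t x ^ b * t y ^ a)" for a b
  define G where "G = (\<lambda>(a, b). M a b) ` {(a, b). a \<le> b \<and> b \<le> s}"
  have fin: "finite {(a, b). a \<le> b \<and> b \<le> s}"
    by (rule finite_subset[of _ "{..s} \<times> {..s}"]) auto
  have MG: "M a b \<in> G" if "a \<le> s" "b \<le> s" for a b
  proof (cases "a \<le> b")
    case True
    then show ?thesis using that by (auto simp: G_def)
  next
    case False
    have "M a b = M b a" by (simp add: M_def vec_eq_iff)
    then show ?thesis using that False by (auto simp: G_def)
  qed
  have F_span: "F T \<in> span G" if TL: "T \<in> set L" for T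
  proof -
    obtain D p q where T: "T = (D, p, q)" by (cases T)
    obtain c where c: "\<And>x. h D x = (\<Sum>a\<le>s. c a * t x ^ a)"
    proof -
      have "finite D" "card D \<le> s"
        using avoid TL T by auto
      then obtain c where "\<forall>x. (\<Prod>d\<in>D. x - t d) = (\<Sum>a\<le>s. c a * x ^ a)"
        using prod_differences_expansion by blast
      then have "h D x = (\<Sum>a\<le>s. c a * t x ^ a)" for x
        by (simp add: h_def)
      then show ?thesis by (rule that)
    qed
    \<comment> \<open>The sum over all ordered \<open>a\<close>, \<open>b\<close> of two-term
      matrices yields every product twice, hence the factor 1/2.\<close>
    have "F T = (1/2) *\<^sub>R (\<Sum>a\<le>s. \<Sum>b\<le>s. (c a * c b) *\<^sub>R M a b)"
    proof -
      have "F T $ x $ y = ((1/2) *\<^sub>R (\<Sum>a\<le>s. \<Sum>b\<le>s. (c a * c b) *\<^sub>R M a b)) $ x $ y" for x y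
      proof -
        have xy: "h D x * h D y = (\<Sum>a\<le>s. \<Sum>b\<le>s. c a * c b * (t x ^ a * t y ^ b))"
          unfolding c sum_product by (simp add: mult_ac)
        have yx: "h D x * h D y = (\<Sum>a\<le>s. \<Sum>b\<le>s. c a * c b * (t x ^ b * t y ^ a))"
          unfolding c sum_product by (subst sum.swap) (simp add: mult_ac)
        have "((1/2) *\<^sub>R (\<Sum>a\<le>s. \<Sum>b\<le>s. (c a * c b) *\<^sub>R M a b)) $ x $ y
          = ((\<Sum>a\<le>s. \<Sum>b\<le>s. c a * c b * (t x ^ a * t y ^ b))
            + (\<Sum>a\<le>s. \<Sum>b\<le>s. c a * c b * (t x ^ b * t y ^ a))) / 2"
          by (simp add: M_def distrib_left sum.distrib)
        also have "\<dots> = h D x * h D y"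
          unfolding xy[symmetric] yx[symmetric] by simp
        finally show ?thesis by (simp add: F_def T)
      qed
      then show ?thesis by (simp add: vec_eq_iff)
    qed
    also have "\<dots> \<in> span G"
      by (intro span_scale span_sum span_base MG) auto
    finally show ?thesis .
  qed
  \<comment> \<open>Triangular independence: the entry at the last pair \<open>(p, q)\<close> is
    zero in all earlier matrices but not in the last one.\<close>
  have "length L \<le> dim (F ` set L)"
    using avoid meet
  proof (induction L rule: rev_induct)
    case (snoc T L)
    obtain D p q where T: "T = (D, p, q)" by (cases T)
    have "F T \<notin> span (F ` set L)"
    proof
      assume "F T \<in> span (F ` set L)"
      then have "F T $ p $ q = 0"
      proof (induction rule: span_induct)
        show "subspace {v :: real^'q^'q. v $ p $ q = 0}"
          by (auto simp: subspace_def)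
      next
        fix v assume "v \<in> F ` set L"
        then obtain D' p' q' where T': "(D', p', q') \<in> set L" "v = F (D', p', q')" by auto
        then have "p \<in> D' \<or> q \<in> D'"
          using snoc.prems(2) T by (auto simp: sorted_wrt_append)
        then show "v $ p $ q = 0"
          using h0 by (auto simp: F_def T')
      qed
      then show False
        using snoc.prems(1)[of D p q] T h0 by (auto simp: F_def)
    qed
    moreover have "length L \<le> dim (F ` set L)"
      using snoc.prems by (intro snoc.IH) (auto simp: sorted_wrt_append)
    ultimately show ?case
      by (simp add: dim_insert)
  qed simp
  also have "\<dots> \<le> card G"
    by (rule dim_le_card) (use F_span fin in \<open>auto simp: G_def\<close>)
  also have "\<dots> \<le> card {(a, b). a \<le> b \<and> b \<le> s}"
    unfolding G_def by (rule card_image_le[OF fin])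
  finally show ?thesis
    by (simp only: card_ordered_pairs_upto)
qed

section \<open>Compressing subsets\<close>

lemma tr_Nil [simp]: "tr \<delta> q [] = q"
  and tr_Cons [simp]: "tr \<delta> q (a # v) = tr \<delta> (\<delta> q a) v"
  and tr_append [simp]: "tr \<delta> q (u @ v) = tr \<delta> (tr \<delta> q u) v"
  by (simp_all add: tr_def)

lemma trs_Nil [simp]: "trs \<delta> T [] = T"
  and trs_append [simp]: "trs \<delta> T (u @ v) = trs \<delta> (trs \<delta> T u) v"
  by (auto simp: trs_def image_image)

lemma trs_mono: "T \<subseteq> U \<Longrightarrow> trs \<delta> T v \<subseteq> trs \<delta> U v"
  by (auto simp: trs_def)

lemma card_trs_le: "finite T \<Longrightarrow> card (trs \<delta> T v) \<le> card T"
  by (simp add: trs_def card_image_le)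

lemma card_trs_less_iff:
  assumes "finite T"
  shows "card (trs \<delta> T v) < card T \<longleftrightarrow> (\<exists>p\<in>T. \<exists>q\<in>T. p \<noteq> q \<and> tr \<delta> p v = tr \<delta> q v)"
proof -
  have "card (trs \<delta> T v) = card T \<longleftrightarrow> inj_on (\<lambda>q. tr \<delta> q v) T"
    unfolding trs_def using assms card_image eq_card_imp_inj_on by blast
  with card_trs_le[OF assms, of \<delta> v] show ?thesis
    unfolding inj_on_def by (metis nat_less_le)
qed

lemma tr_closed:
  assumes "\<And>q a. q \<in> R \<Longrightarrow> \<delta> q a \<in> R" "q \<in> R"
  shows "tr \<delta> q v \<in> R"
  using assms(2) by (induction v arbitrary: q) (simp_all add: assms(1))

text \<open>A pair merged by \<open>v\<close> is followed along \<open>v\<close>. A proper prefix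
  merging it would be a shorter compressing word, so the pair stays distinct until the end.\<close>

lemma compression_pairs:
  assumes "finite P" "card (trs \<delta> P v) < card P"
    and shortest: "\<And>u. length u < length v \<Longrightarrow> \<not> card (trs \<delta> P u) < card P"
  obtains p q where
    "\<And>i. i < length v \<Longrightarrow> p i \<in> trs \<delta> P (take i v) \<and> q i \<in> trs \<delta> P (take i v) \<and> p i \<noteq> q i
      \<and> tr \<delta> (p i) (drop i v) = tr \<delta> (q i) (drop i v)"
proof -
  obtain p q where pq: "p \<in> P" "q \<in> P" "p \<noteq> q" "tr \<delta> p v = tr \<delta> q v"
    using assms(2) card_trs_less_iff[OF assms(1)] by blast
  show ?thesis
  proof (rule that[of "\<lambda>i. tr \<delta> p (take i v)" "\<lambda>i. tr \<delta> q (take i v)"])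
    fix i assume "i < length v"
    then have "tr \<delta> p (take i v) \<noteq> tr \<delta> q (take i v)"
      using shortest[of "take i v"] pq card_trs_less_iff[OF assms(1)] by (metis length_take min.absorb4)
    with pq show "tr \<delta> p (take i v) \<in> trs \<delta> P (take i v) \<and> tr \<delta> q (take i v) \<in> trs \<delta> P (take i v)
      \<and> tr \<delta> p (take i v) \<noteq> tr \<delta> q (take i v)
      \<and> tr \<delta> (tr \<delta> p (take i v)) (drop i v) = tr \<delta> (tr \<delta> q (take i v)) (drop i v)"
      by (auto simp: trs_def simp flip: tr_append)
  qed
qed

text \<open>The extremal situation of \<open>rank_drop_three\<close> below: \<open>f b\<close> is the action of the letter \<open>b\<close>, \<open>C\<close> is the set of
  letters that are not permutations of \<open>R\<close>, and \<open>att n D\<close> says that \<open>R - D\<close> is the image of \<open>R\<close> under a word of length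
  at most \<open>n\<close>. The conditions \<open>att4\<close>, \<open>att5\<close>, \<open>att6\<close> come from the skew Bollobas inequality.\<close>

lemma three_state_closed_set:
  fixes f :: "'b \<Rightarrow> 'q \<Rightarrow> 'q" and att :: "nat \<Rightarrow> 'q set \<Rightarrow> bool"
  assumes ex: "e \<in> R" "x \<in> R" "e \<noteq> x"
    and C_merge: "\<And>c. c \<in> C \<Longrightarrow> f c e = f c x"
    and C_inj: "\<And>c. c \<in> C \<Longrightarrow> inj_on (f c) (R - {e})"
    and C_image: "\<And>c s. c \<in> C \<Longrightarrow> s \<in> R \<Longrightarrow> f c s \<noteq> e"
    and perm: "\<And>b. b \<notin> C \<Longrightarrow> inj_on (f b) R"
    and closed: "\<And>b s. s \<in> R \<Longrightarrow> f b s \<in> R"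
    and perm_e: "\<And>b. b \<notin> C \<Longrightarrow> f b e \<in> {e, x}"
    and a1: "a1 \<notin> C" "f a1 e = x"
    and a2: "a2 \<notin> C" "f a2 x \<notin> {e, x}"
    and c0: "c0 \<in> C"
    and att_x: "att 2 {x}"
    and att_mono: "\<And>n m D. att n D \<Longrightarrow> n \<le> m \<Longrightarrow> att m D"
    and att_perm: "\<And>n D b. att n D \<Longrightarrow> b \<notin> C \<Longrightarrow> D \<subseteq> R \<Longrightarrow> att (Suc n) (f b ` D)"
    and att_C1: "\<And>n s c. att n {s} \<Longrightarrow> s \<in> R - {e, x} \<Longrightarrow> c \<in> C \<Longrightarrow> att (Suc n) {e, f c s}"
    and att_C2: "\<And>n s c. att n {e, s} \<Longrightarrow> s \<in> R - {e} \<Longrightarrow> c \<in> C \<Longrightarrow> att (Suc n) {e, f c s}"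
    and att4: "\<And>D1 D2. att 4 D1 \<Longrightarrow> att 4 D2 \<Longrightarrow> card D1 = 2 \<Longrightarrow> card D2 = 2 \<Longrightarrow> D1 = D2"
    and att5: "\<And>D1 D2 D3. att 5 D1 \<Longrightarrow> att 5 D2 \<Longrightarrow> att 5 D3 \<Longrightarrow>
      card D1 = 2 \<Longrightarrow> card D2 = 2 \<Longrightarrow> card D3 = 2 \<Longrightarrow> D1 = D2 \<or> D3 = D1 \<or> D3 = D2"
    and att6: "\<And>p q r s u. att 6 {e, p} \<Longrightarrow> att 6 {e, q} \<Longrightarrow> att 6 {e, r} \<Longrightarrow> att 6 {s, u} \<Longrightarrow>
      distinct [e, p, q, r] \<Longrightarrow> {p, q, r} \<subseteq> R \<Longrightarrow> e \<notin> {s, u} \<Longrightarrow> s \<noteq> u \<Longrightarrow> False"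
  shows "\<exists>K. e \<in> K \<and> K \<subseteq> R \<and> card K \<le> 3 \<and> (\<forall>b. f b ` K \<subseteq> K)"
proof -
  \<comment> \<open>The missing state \<open>x\<close> moves to \<open>y\<close> under
    \<open>a2\<close>, and then \<open>c0\<close> turns \<open>{y}\<close> into the missing set
    \<open>{e, z}\<close>.\<close>
  define y where "y = f a2 x"
  define z where "z = f c0 y"
  have injC: "s = t" if "c \<in> C" "s \<in> R" "t \<in> R" "s \<noteq> e" "t \<noteq> e" "f c s = f c t" for c s t
    using inj_onD[OF C_inj[OF that(1)] that(6)] that by auto
  have injP: "s = t" if "b \<notin> C" "s \<in> R" "t \<in> R" "f b s = f b t" for b s t
    using inj_onD[OF perm[OF that(1)] that(4)] that by auto
  have R: "y \<in> R" "z \<in> R" "y \<noteq> e" "y \<noteq> x" "z \<noteq> e"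
    using ex closed a2 c0 C_image by (auto simp: y_def z_def)
  have att3: "att 3 {f b x}" if "b \<notin> C" for b
    using att_perm[OF att_x that] ex by (simp add: numeral_eq_Suc)
  have x4: "att 4 {e, f c (f b x)}" if "b \<notin> C" "f b x \<notin> {e, x}" "c \<in> C" for b c
    using att_C1[OF att3[OF that(1)]] that closed ex by (simp add: numeral_eq_Suc)
  \<comment> \<open>Both \<open>{e, f c (f b x)}\<close> and \<open>{e, z}\<close> are missed within
    4 letters, and \<open>att4\<close> allows only one such set.\<close>
  have z_eq: "f c (f b x) = z" if "b \<notin> C" "f b x \<notin> {e, x}" "c \<in> C" for b c
    using att4[OF x4[OF that] x4[OF a2 c0]] C_image[OF that(3) closed[OF ex(2)], of b] R
    by (auto simp: y_def z_def doubleton_eq_iff)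
  have yc: "f c y = z" if "c \<in> C" for c
    using z_eq[of a2 c] a2 that by (simp add: y_def)
  have x_img: "f b x \<in> {e, x, y}" if "b \<notin> C" for b
    using z_eq[OF that _ c0] yc[OF c0] injC[OF c0, of "f b x" y] closed ex R by auto
  have T4: "att 4 {e, z}"
    using att_C1[OF att3[OF a2(1)], of c0] a2 c0 R by (simp add: numeral_eq_Suc y_def z_def)
  have T5: "att 5 {e, z}" and T6: "att 6 {e, z}"
    using att_mono[OF T4] by simp_all
  have P5: "att 5 {f b e, f b z}" if "b \<notin> C" for b
    using att_perm[OF T4 that] R ex by (simp add: numeral_eq_Suc)
  have C5: "att 5 {e, f c z}" if "c \<in> C" for c
    using att_C2[OF T4 _ that] R by (simp add: numeral_eq_Suc)
  have y4: "att 4 {f b y}" if "b \<notin> C" for b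
    using att_perm[OF att3[OF a2(1)] that] R by (simp add: numeral_eq_Suc y_def)
  have Y5: "att 5 {e, f c (f b y)}" if "b \<notin> C" "f b y \<notin> {e, x}" "c \<in> C" for b c
    using att_C1[OF y4[OF that(1)] _ that(3)] that R closed by (simp add: numeral_eq_Suc)
  have c0R: "f c s \<in> R" "f c s \<noteq> e" if "c \<in> C" "s \<in> R" for c s
    using that closed C_image by auto
  \<comment> \<open>By \<open>att5\<close> at most one pair besides \<open>{e, z}\<close> is missed
    within 5 letters. It is \<open>{e, x}\<close> in A1, the pair \<open>{x, f a1 z}\<close>
    avoiding \<open>e\<close> in A2, and \<open>{e, f c0 x}\<close> in B.\<close>
  consider (A1) "z \<noteq> x" "f a1 z = e" | (A2) "z \<noteq> x" "f a1 z \<noteq> e" | (B) "z = x"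
    by blast
  then show ?thesis
  proof cases
    case A1
    have X5: "att 5 {e, x}"
      using P5[OF a1(1)] A1 a1 by (simp add: insert_commute)
    have U: "{p, q} = {e, z} \<or> {p, q} = {e, x}" if "att 5 {p, q}" "p \<noteq> q" for p q
      using att5[OF T5 X5 that(1)] that(2) A1 R ex by (auto simp: doubleton_eq_iff)
    have zc: "f c z \<in> {z, x}" if "c \<in> C" for c
      using U[OF C5[OF that]] c0R[OF that] R by (auto simp: doubleton_eq_iff)
    have zp: "f b z \<in> {e, x, z}" if "b \<notin> C" for b
    proof -
      have "f b e \<noteq> f b z" using injP[OF that ex(1) R(2)] R by auto
      then show ?thesis
        using U[OF P5[OF that]] by (auto simp: doubleton_eq_iff)
    qed
    have u: "f a1 x \<noteq> e" "f a1 x \<noteq> x"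
      using injP[OF a1(1) ex(2) R(2)] injP[OF a1(1) ex(2,1)] A1 a1 ex by auto
    \<comment> \<open>This missing pair avoids \<open>e\<close>, so \<open>att6\<close> excludes
      three different missing pairs through \<open>e\<close>; this confines \<open>f c x\<close>
      below.\<close>
    have S6: "att 6 {x, f a1 x}"
      using att_perm[OF X5 a1(1)] a1 ex by (simp add: numeral_eq_Suc)
    have X6: "att 6 {e, f c x}" if "c \<in> C" for c
      using att_C2[OF X5 _ that] ex by (simp add: numeral_eq_Suc)
    have xc: "f c x \<in> {x, z}" if "c \<in> C" for c
    proof (rule ccontr)
      assume "f c x \<notin> {x, z}"
      then have "distinct [e, z, x, f c x]" "{z, x, f c x} \<subseteq> R"
        using c0R[OF that ex(2)] A1 R ex by auto
      then show False
        using att6[OF T6 att_mono[OF X5] X6[OF that] S6] u ex by auto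
    qed
    have "y = z"
    proof (rule ccontr)
      assume "y \<noteq> z"
      then have "f c0 z = x"
        using zc[OF c0] yc[OF c0] injC[OF c0 R(2,1)] R by auto
      then show False
        using xc[OF c0] injC[OF c0 R(2) ex(2)] injC[OF c0 R(1) ex(2)] yc[OF c0] A1 R ex by auto
    qed
    show ?thesis
    proof (intro exI[of _ "{e, x, z}"] conjI allI)
      show "f b ` {e, x, z} \<subseteq> {e, x, z}" for b
      proof (cases "b \<in> C")
        case True
        then show ?thesis using xc zc C_merge by auto
      next
        case False
        then show ?thesis using x_img zp perm_e \<open>y = z\<close> by auto
      qed
    qed (use ex R in \<open>auto simp: card_insert_if\<close>)
  next
    \<comment> \<open>This case is contradictory: it forces \<open>y = z\<close> to be fixed by the
      permutation \<open>a2\<close>, which already maps \<open>x\<close> to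
      \<open>y\<close>.\<close>
    case A2
    have z': "f a1 z \<noteq> x"
      using injP[OF a1(1) R(2) ex(1)] a1 R by auto
    have X5: "att 5 {x, f a1 z}"
      using P5[OF a1(1)] a1 by simp
    have U: "{p, q} = {e, z} \<or> {p, q} = {x, f a1 z}" if "att 5 {p, q}" "p \<noteq> q" for p q
      using att5[OF T5 X5 that(1)] that(2) A2 z' R ex by (auto simp: doubleton_eq_iff)
    have zc: "f c0 z = z"
      using U[OF C5[OF c0]] c0R[OF c0 R(2)] A2 R ex by (auto simp: doubleton_eq_iff)
    then have "y = z"
      using yc[OF c0] injC[OF c0 R(1,2)] R by auto
    have "att 5 {e, f c0 (f a1 z)}"
      using Y5[OF a1(1) _ c0] A2 z' \<open>y = z\<close> by auto
    then have "f c0 (f a1 z) = z"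
      using U c0R[OF c0 closed[OF R(2), of a1]] A2 R ex by (fastforce simp: doubleton_eq_iff)
    then have "f a1 z = z"
      using zc injC[OF c0 closed[OF R(2)] R(2)] A2 R by auto
    moreover have "f a2 e \<noteq> f a2 z"
      using injP[OF a2(1) ex(1) R(2)] R by auto
    ultimately have "f a2 z = z"
      using U[OF P5[OF a2(1)]] perm_e[OF a2(1)] A2 ex R by (auto simp: doubleton_eq_iff)
    then show ?thesis
      using injP[OF a2(1) ex(2) R(2)] A2 \<open>y = z\<close> by (simp add: y_def)
  next
    case B
    have t: "f c x \<noteq> x" "f c x \<noteq> e" if "c \<in> C" for c
      using yc[OF that] injC[OF that R(1) ex(2)] c0R[OF that ex(2)] B R ex by auto
    have X5: "att 5 {e, f c x}" if "c \<in> C" for c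
      using C5[OF that] B by simp
    define t where "t = f c0 x"
    have tt: "t \<noteq> e" "t \<noteq> x" using t[OF c0] by (auto simp: t_def)
    have U: "{p, q} = {e, x} \<or> {p, q} = {e, t}" if "att 5 {p, q}" "p \<noteq> q" for p q
      using att5[OF T5 X5[OF c0] that(1)] that(2) B tt ex unfolding t_def[symmetric]
      by (auto simp: doubleton_eq_iff)
    \<comment> \<open>As \<open>z = x\<close>, the letter \<open>a2\<close> maps
      \<open>{e, z}\<close> to \<open>{f a2 e, y}\<close>. This must be \<open>{e, t}\<close>,
      because \<open>y\<close> is neither \<open>e\<close> nor \<open>x\<close>.\<close>
    have "f a2 e \<noteq> y"
      using injP[OF a2(1) ex(1,2)] ex by (auto simp: y_def)
    then have "y = t"
      using U[OF P5[OF a2(1)]] B R unfolding y_def[symmetric]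
      by (auto simp: doubleton_eq_iff y_def)
    have xc: "f c x = y" if "c \<in> C" for c
      using U[OF X5[OF that]] t[OF that] \<open>y = t\<close> by (auto simp: doubleton_eq_iff)
    have yp: "f b y \<in> {e, x, y}" if "b \<notin> C" for b
    proof (rule ccontr)
      assume *: "f b y \<notin> {e, x, y}"
      have "f c0 (f b y) \<in> {x, y}"
        using U[OF Y5[OF that _ c0]] * c0R[OF c0 closed[OF R(1), of b]] \<open>y = t\<close>
        by (auto simp: doubleton_eq_iff)
      then show False
        using * yc[OF c0] xc[OF c0] B injC[OF c0 closed[OF R(1), of b] R(1)]
          injC[OF c0 closed[OF R(1), of b] ex(2)] R ex by auto
    qed
    show ?thesis
    proof (intro exI[of _ "{e, x, y}"] conjI allI)
      show "f b ` {e, x, y} \<subseteq> {e, x, y}" for b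
      proof (cases "b \<in> C")
        case True
        then show ?thesis using xc yc C_merge B by auto
      next
        case False
        then show ?thesis using x_img yp perm_e by auto
      qed
    qed (use ex R in \<open>auto simp: card_insert_if\<close>)
  qed
qed

text \<open>\<open>R\<close> is a closed subset and \<open>'b\<close> is arbitrary, so that
  \<open>R = Q.w\<close> with words as letters is an instance.\<close>

locale synchronizing_on =
  fixes \<delta> :: "'q::finite \<Rightarrow> 'b \<Rightarrow> 'q" and R :: "'q set"
  assumes closed: "q \<in> R \<Longrightarrow> \<delta> q a \<in> R"
    and sync: "\<exists>v. card (trs \<delta> R v) = 1"
begin

lemma trs_subset: "P \<subseteq> R \<Longrightarrow> trs \<delta> P v \<subseteq> R"
  using tr_closed[of R \<delta>, OF closed] by (auto simp: trs_def)

text \<open>If the pair at time \<open>j\<close> lay in the image at an earlier time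
  \<open>i\<close>, cutting out the letters between would give a shorter compressing word. So
  complements of images and surviving pairs form a skew system. Minimality of \<open>v\<close> is
  part of the conclusion for use in the tight case.\<close>

lemma shortest_compression:
  assumes "P \<subseteq> R" "2 \<le> card P"
  obtains v where "card (trs \<delta> P v) < card P"
    "\<And>u. length u < length v \<Longrightarrow> \<not> card (trs \<delta> P u) < card P"
    "length v \<le> (card R - card P + 2) choose 2"
proof -
  obtain v0 where "card (trs \<delta> R v0) = 1"
    using sync by blast
  moreover have "card (trs \<delta> P v0) \<le> card (trs \<delta> R v0)"
    by (rule card_mono) (simp_all add: assms trs_mono)
  ultimately have "card (trs \<delta> P v0) < card P"
    using assms by simp
  then obtain v where v: "card (trs \<delta> P v) < card P"
    "\<And>u. card (trs \<delta> P u) < card P \<Longrightarrow> length v \<le> length u"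
    using ex_has_least_nat[of "\<lambda>v. card (trs \<delta> P v) < card P" v0 length] by blast
  then have shortest: "\<And>u. length u < length v \<Longrightarrow> \<not> card (trs \<delta> P u) < card P"
    by (meson not_le)
  obtain p q where pq: "\<And>i. i < length v \<Longrightarrow> p i \<in> trs \<delta> P (take i v) \<and> q i \<in> trs \<delta> P (take i v)
      \<and> p i \<noteq> q i \<and> tr \<delta> (p i) (drop i v) = tr \<delta> (q i) (drop i v)"
    using compression_pairs[OF _ v(1) shortest] by auto
  have same: "card (trs \<delta> P (take i v)) = card P" if "i < length v" for i
    using shortest[of "take i v"] card_trs_le[of P \<delta> "take i v"] that by simp
  have miss: "p j \<notin> trs \<delta> P (take i v) \<or> q j \<notin> trs \<delta> P (take i v)" if "i < j" "j < length v" for i j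
  proof (rule ccontr)
    assume "\<not> ?thesis"
    then have "card (trs \<delta> (trs \<delta> P (take i v)) (drop j v)) < card (trs \<delta> P (take i v))"
      using pq[OF that(2)] by (subst card_trs_less_iff) auto
    with same[of i] that have "card (trs \<delta> P (take i v @ drop j v)) < card P"
      by simp
    with shortest[of "take i v @ drop j v"] that show False by simp
  qed
  define L where "L = map (\<lambda>i. (R - trs \<delta> P (take i v), p i, q i)) [0..<length v]"
  have R: "p i \<in> R" "q i \<in> R" if "i < length v" for i
    using pq[OF that] trs_subset[OF assms(1)] by auto
  have "length L \<le> (card R - card P + 2) choose 2"
  proof (rule skew_bollobas_pairs)
    fix D p' q' assume "(D, p', q') \<in> set L"
    then obtain i where i: "i < length v" "D = R - trs \<delta> P (take i v)" "p' = p i" "q' = q i"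
      by (auto simp: L_def)
    then show "card D \<le> card R - card P \<and> p' \<notin> D \<and> q' \<notin> D"
      using pq[OF i(1)] same[OF i(1)] by (simp add: card_Diff_subset trs_subset[OF assms(1)])
  next
    show "sorted_wrt (\<lambda>(D, _) (_, p, q). p \<in> D \<or> q \<in> D) L"
      using miss R by (auto simp: L_def sorted_wrt_iff_nth_less)
  qed
  then have "length v \<le> (card R - card P + 2) choose 2"
    by (simp add: L_def)
  with v(1) shortest show ?thesis by (rule that)
qed

lemma short_compression:
  assumes "P \<subseteq> R" "2 \<le> card P"
  shows "\<exists>v. card (trs \<delta> P v) < card P \<and> length v \<le> (card R - card P + 2) choose 2"
  using shortest_compression[OF assms] by blast

text \<open>Every rank from \<open>card P\<close> down to 2 is charged one compression; skipping
  ranks only removes summands.\<close>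

lemma short_reset:
  assumes "P \<subseteq> R" "P \<noteq> {}"
  shows "\<exists>v. card (trs \<delta> P v) = 1 \<and> length v \<le> (\<Sum>j = 2..card P. (card R - j + 2) choose 2)"
  using assms
proof (induction "card P" arbitrary: P rule: less_induct)
  case less
  show ?case
  proof (cases "card P = 1")
    case True
    then show ?thesis by (intro exI[of _ "[]"]) simp
  next
    case False
    then have P2: "2 \<le> card P"
      using less.prems by (metis One_nat_def Suc_1 Suc_leI card_gt_0_iff finite le_neq_implies_less)
    obtain v where v: "card (trs \<delta> P v) < card P" "length v \<le> (card R - card P + 2) choose 2"
      using short_compression[OF less.prems(1) P2] by blast
    have "trs \<delta> P v \<noteq> {}"
      using less.prems by (simp add: trs_def)
    from less.hyps[OF v(1) trs_subset[OF less.prems(1)] this]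
    obtain u where u: "card (trs \<delta> (trs \<delta> P v) u) = 1"
      "length u \<le> (\<Sum>j = 2..card (trs \<delta> P v). (card R - j + 2) choose 2)"
      by blast
    have "{2..card P} = insert (card P) {2..card P - 1}"
      using P2 by auto
    then have split: "(\<Sum>j = 2..card P. (card R - j + 2) choose 2)
      = ((card R - card P + 2) choose 2) + (\<Sum>j = 2..card P - 1. (card R - j + 2) choose 2)"
      using P2 by simp
    have "(\<Sum>j = 2..card (trs \<delta> P v). (card R - j + 2) choose 2)
      \<le> (\<Sum>j = 2..card P - 1. (card R - j + 2) choose 2)"
      using v(1) by (intro sum_mono2) auto
    with u v split show ?thesis
      by (intro exI[of _ "v @ u"]) simp
  qed
qed

text \<open>A reset word would have to end both in \<open>K\<close> and in
  \<open>R - K\<close>.\<close>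

lemma no_disjoint_closed_subsets:
  assumes "K \<subseteq> R" "K \<noteq> {}" "K \<noteq> R"
    and K: "\<And>s b. s \<in> K \<Longrightarrow> \<delta> s b \<in> K"
    and co: "\<And>s b. s \<in> R - K \<Longrightarrow> \<delta> s b \<in> R - K"
  shows False
proof -
  obtain v t where v: "trs \<delta> R v = {t}"
    using sync card_1_singletonE by metis
  obtain s s' where s: "s \<in> K" "s' \<in> R - K"
    using assms by blast
  then have "tr \<delta> s v = t" "tr \<delta> s' v = t"
    using v \<open>K \<subseteq> R\<close> by (auto simp: trs_def)
  with tr_closed[of K \<delta>, OF K s(1), of v] tr_closed[of "R - K" \<delta>, OF co s(2), of v]
  show False by simp
qed

text \<open>If 9 letters do not suffice, then all words of length at most 3 have rank at least \<open>r - 1\<close>,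
  which forces every non-permutation letter to merge the same pair \<open>{e, x}\<close> and to miss the same
  state \<open>e\<close>. Some image of size \<open>r - 2\<close> after 4 letters then needs 6 letters to be compressed, so the
  Frankl--Pin bound is attained with equality. Hence the polynomials of the complements of \<open>(r - 2)\<close>-element
  images reached within \<open>4 + i\<close> letters span a space of dimension at most \<open>i + 1\<close>.\<close>

lemma rank_drop_three:
  assumes r: "4 \<le> card R"
  shows "\<exists>v. length v \<le> 9 \<and> card (trs \<delta> R v) \<le> card R - 3"
proof (rule ccontr)
  assume no: "\<not> ?thesis"
  have two: "2 \<le> card R - 2" and defects: "card R - (card R - 1) + 2 = 3" "card R - (card R - 2) + 2 = 4"
    using r by linarith+

  \<comment> \<open>Lower bounds on the rank of short words\<close>
  have H: "card R - 2 \<le> card (trs \<delta> R v)" if "length v \<le> 9" for v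
  proof -
    have "\<not> card (trs \<delta> R v) \<le> card R - 3"
      using no that by blast
    then show ?thesis by linarith
  qed
  \<comment> \<open>Rank \<open>card R - 2\<close> within 3 letters could be compressed by 6 more,
    since 4 choose 2 is 6, contradicting \<open>H\<close>.\<close>
  have F: "card R - 1 \<le> card (trs \<delta> R v)" if "length v \<le> 3" for v
  proof (rule ccontr)
    assume "\<not> ?thesis"
    with H[of v] that have card: "card (trs \<delta> R v) = card R - 2"
      by simp
    obtain u where u: "card (trs \<delta> (trs \<delta> R v) u) < card (trs \<delta> R v)"
      "length u \<le> (card R - card (trs \<delta> R v) + 2) choose 2"
      using short_compression[of "trs \<delta> R v"] card two trs_subset[of R v] by auto
    have "length u \<le> 6"
      using u(2) card defects by (simp add: choose_two)
    with H[of "v @ u"] u(1) card that show False by simp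
  qed

  \<comment> \<open>Structure of the letters\<close>
  define f where "f b = (\<lambda>q. \<delta> q b)" for b
  have trs1: "trs \<delta> P [b] = f b ` P" for P b
    by (simp add: f_def trs_def)
  have trs_snoc: "trs \<delta> P (v @ [b]) = f b ` trs \<delta> P v" for P v b
    by (simp add: trs1)
  have fR: "f b s \<in> R" if "s \<in> R" for b s
    using closed[OF that] by (simp add: f_def)
  define C where "C = {c. card (f c ` R) < card R}"
  have miss_one: "\<exists>s\<in>R. trs \<delta> R v = R - {s}" if "length v \<le> 3" "card (trs \<delta> R v) < card R" for v
  proof -
    have "card (R - trs \<delta> R v) = 1"
      using F[OF that(1)] that(2) r by (simp add: card_Diff_subset trs_subset)
    then obtain s where "R - trs \<delta> R v = {s}"
      using card_1_singletonE by blast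
    then show ?thesis
      using trs_subset[of R v] by blast
  qed
  \<comment> \<open>Otherwise \<open>v @ [c]\<close> would drop the rank by two within 3 letters,
    against \<open>F\<close>.\<close>
  have meets: "s \<in> {p, q}" if "trs \<delta> R v = R - {s}" "s \<in> R" "length v \<le> 2"
    "p \<in> R" "q \<in> R" "p \<noteq> q" "f c p = f c q" for v s p q c
  proof (rule ccontr)
    assume "s \<notin> {p, q}"
    then have "card (trs \<delta> (R - {s}) [c]) < card (R - {s})"
      using that by (subst card_trs_less_iff) (auto simp: f_def)
    then have "card (trs \<delta> R (v @ [c])) < card R - 1"
      using that by simp
    with F[of "v @ [c]"] that(3) show False by simp
  qed
  obtain a where a: "a \<in> C"
  proof -
    obtain v where v: "card (trs \<delta> R v) < card R" "length v \<le> 1"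
      using short_compression[of R] r by (auto simp: choose_two)
    then obtain b where "v = [b]"
      by (cases v) auto
    then show ?thesis using v that by (auto simp: C_def trs1)
  qed
  have "card (trs \<delta> R [a]) < card R"
    using a by (simp add: C_def trs1)
  then obtain e where e: "e \<in> R" "trs \<delta> R [a] = R - {e}"
    using miss_one[of "[a]"] by auto
  \<comment> \<open>Three letters suffice to compress \<open>R - {e}\<close>, and by
    \<open>F\<close> two do not, so the word has exactly the form
    \<open>[a1, a2, c0]\<close>.\<close>
  have "2 \<le> card (R - {e})" "(card R - card (R - {e}) + 2) choose 2 = 3"
    using e r defects by (simp_all add: choose_two)
  with short_compression[of "R - {e}"]
  obtain v3 where "card (trs \<delta> (R - {e}) v3) < card R - 1" "length v3 \<le> 3"
    using e by auto
  moreover from this have "\<not> length (a # v3) \<le> 3"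
    using F[of "a # v3"] e trs_append[of \<delta> R "[a]" v3] by auto
  ultimately have "length v3 = 3"
    by simp
  then obtain a1 a2 c0 where v3: "v3 = [a1, a2, c0]"
    by (auto simp: numeral_eq_Suc length_Suc_conv)
  have drop2: "card (trs \<delta> R [a, a1, a2, c0]) < card R - 1"
    using \<open>card (trs \<delta> (R - {e}) v3) < card R - 1\<close> e trs_append[of \<delta> R "[a]" v3] v3 by simp
  have less: "card (trs \<delta> R (b # v)) < card R" if "b \<in> C" for b v
  proof -
    have "card (trs \<delta> R (b # v)) \<le> card (trs \<delta> R [b])"
      using card_trs_le[of "trs \<delta> R [b]" \<delta> v] trs_append[of \<delta> R "[b]" v] by simp
    then show ?thesis using that by (simp add: C_def trs1)
  qed
  obtain x where x: "x \<in> R" "trs \<delta> R [a, a1] = R - {x}"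
    using miss_one[of "[a, a1]"] less[OF a] by auto
  obtain y where y: "y \<in> R" "trs \<delta> R [a, a1, a2] = R - {y}"
    using miss_one[of "[a, a1, a2]"] less[OF a] by auto
  have trs_aa1: "f a1 ` (R - {e}) = R - {x}" and trs_aa1a2: "f a2 ` (R - {x}) = R - {y}"
    using e x y trs_snoc[of R "[a]" a1] trs_snoc[of R "[a, a1]" a2] by simp_all
  have "card (trs \<delta> (R - {y}) [c0]) < card (R - {y})"
    using drop2 y trs_append[of \<delta> R "[a, a1, a2]" "[c0]"] by simp
  then obtain p0 q0 where p0: "p0 \<in> R - {y}" "q0 \<in> R - {y}" "p0 \<noteq> q0" "f c0 p0 = f c0 q0"
    by (subst (asm) card_trs_less_iff) (auto simp: f_def)
  \<comment> \<open>Otherwise \<open>a1\<close> could be skipped: \<open>[a, a2]\<close> would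
    already miss \<open>y\<close>, and \<open>c0\<close> merges a pair avoiding
    \<open>y\<close>.\<close>
  have "e \<noteq> x"
  proof
    assume "e = x"
    then have "trs \<delta> R [a, a2] = R - {y}"
      using trs_snoc[of R "[a]" a2] e trs_aa1a2 by simp
    from meets[OF this y(1) _ _ _ p0(3,4)] p0 show False by auto
  qed
  moreover have "e \<in> {p0, q0}" "x \<in> {p0, q0}"
    using meets[OF e(2,1) _ _ _ p0(3,4)] meets[OF x(2,1) _ _ _ p0(3,4)] p0 by auto
  ultimately have c0_merge: "f c0 e = f c0 x" and y_ex: "y \<noteq> e" "y \<noteq> x"
    using p0 by auto
  have c0: "c0 \<in> C"
    using card_trs_less_iff[of R \<delta> "[c0]"] c0_merge e x \<open>e \<noteq> x\<close>
    by (auto simp: C_def f_def trs1)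
  have C_pair: "{p, q} = {e, x}" if "p \<in> R" "q \<in> R" "p \<noteq> q" "f c p = f c q" for p q c
    using meets[OF e(2,1) _ that] meets[OF x(2,1) _ that] \<open>e \<noteq> x\<close> by auto
  have C_merge: "f c e = f c x" if cC: "c \<in> C" for c
  proof -
    obtain p q where "p \<in> R" "q \<in> R" "p \<noteq> q" "f c p = f c q"
      using card_trs_less_iff[of R \<delta> "[c]"] cC by (auto simp: C_def trs1 f_def)
    with C_pair[OF this] show ?thesis by (auto simp: doubleton_eq_iff)
  qed
  have C_inj: "inj_on (f c) (R - {e})" for c
    using C_pair by (fastforce simp: inj_on_def doubleton_eq_iff)
  \<comment> \<open>The state missed by \<open>c\<close> is \<open>e\<close> or \<open>x\<close>. If
    it were \<open>x\<close>, then \<open>c\<close> would replace both \<open>a\<close> and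
    \<open>a1\<close>, again saving a letter.\<close>
  have C_image: "f c ` R = R - {e}" if cC: "c \<in> C" for c
  proof -
    obtain s where s: "s \<in> R" "trs \<delta> R [c] = R - {s}"
      using miss_one[of "[c]"] less[OF cC] by auto
    have "s \<in> {e, x}"
      using meets[OF s(2,1) _ e(1) x(1) \<open>e \<noteq> x\<close> c0_merge] by simp
    moreover have "s \<noteq> x"
    proof
      assume "s = x"
      then have "trs \<delta> R [c, a2] = R - {y}"
        using trs_snoc[of R "[c]" a2] s trs_aa1a2 by simp
      from meets[OF this y(1) _ e(1) x(1) \<open>e \<noteq> x\<close> c0_merge] y_ex show False by auto
    qed
    ultimately show ?thesis using s by (simp add: trs1)
  qed
  have perm: "inj_on (f b) R" if "b \<notin> C" for b
    using that card_image_le[of R "f b"] by (auto simp: C_def intro: eq_card_imp_inj_on)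
  have perm_image: "f b ` (R - D) = R - f b ` D" if "b \<notin> C" "D \<subseteq> R" for b D
    using inj_on_image_set_diff[OF perm[OF that(1)], of R D] that fR
      endo_inj_surj[OF _ _ perm[OF that(1)]] by (simp add: image_subset_iff)
  have perm_e: "f b e \<in> {e, x}" if "b \<notin> C" for b
  proof -
    have "trs \<delta> R [a, b] = R - {f b e}"
      using trs_snoc[of R "[a]" b] e perm_image[OF that, of "{e}"] by simp
    from meets[OF this fR[OF e(1)] _ e(1) x(1) \<open>e \<noteq> x\<close> c0_merge] show ?thesis by simp
  qed
  have a1: "a1 \<notin> C" "f a1 e = x"
  proof -
    have "e \<in> f a1 ` R"
      using trs_aa1 e(1) \<open>e \<noteq> x\<close> by (auto dest!: equalityD2)
    then show "a1 \<notin> C"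
      using C_image[of a1] by auto
    from perm_image[OF this, of "{e}"] trs_aa1 e x fR[OF e(1), of a1] show "f a1 e = x"
      by auto
  qed
  have a2: "a2 \<notin> C" "f a2 x \<notin> {e, x}"
  proof -
    have "e \<in> f a2 ` R"
      using trs_aa1a2 e(1) y_ex by (auto dest!: equalityD2)
    then show "a2 \<notin> C"
      using C_image[of a2] by auto
    from perm_image[OF this, of "{x}"] trs_aa1a2 y x fR[OF x(1), of a2] have "f a2 x = y"
      by auto
    with y_ex show "f a2 x \<notin> {e, x}" by simp
  qed

  \<comment> \<open>The tight case of the Frankl-Pin bound\<close>
  define P where "P = trs \<delta> R [a, a1, a2, c0]"
  have "P \<subseteq> R" unfolding P_def by (rule trs_subset) simp
  have cardP: "card P = card R - 2"
    using drop2 H[of "[a, a1, a2, c0]"] by (simp add: P_def)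
  obtain v where v: "card (trs \<delta> P v) < card P"
    "\<And>u. length u < length v \<Longrightarrow> \<not> card (trs \<delta> P u) < card P"
    "length v \<le> (card R - card P + 2) choose 2"
    using shortest_compression[OF \<open>P \<subseteq> R\<close>] cardP two by auto
  have "length v \<le> 6"
    using v(3) cardP defects by (simp add: choose_two)
  moreover have "\<not> length ([a, a1, a2, c0] @ v) \<le> 9"
    using H[of "[a, a1, a2, c0] @ v"] v(1) cardP unfolding trs_append P_def[symmetric] by linarith
  ultimately have len: "length v = 6"
    by simp
  obtain p q where pq: "\<And>i. i < 6 \<Longrightarrow> p i \<in> trs \<delta> P (take i v) \<and> q i \<in> trs \<delta> P (take i v)
      \<and> p i \<noteq> q i \<and> tr \<delta> (p i) (drop i v) = tr \<delta> (q i) (drop i v)"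
    using compression_pairs[OF _ v(1,2)] len by auto

  define att where "att n D \<longleftrightarrow> D \<subseteq> R \<and> (\<exists>u. length u \<le> n \<and> trs \<delta> R u = R - D)" for n D
  \<comment> \<open>Otherwise the suffix \<open>drop j v\<close>, of length \<open>6 - j\<close>,
    would compress \<open>R - D\<close>, and \<open>4 + i + 6 - j\<close> is at most 9.\<close>
  have att_meets: "p j \<in> D \<or> q j \<in> D"
    if att: "att (4 + i) D" and "card D = 2" "i < j" "j < 6" for i j D
  proof (rule ccontr)
    assume *: "\<not> ?thesis"
    obtain u where u: "D \<subseteq> R" "length u \<le> 4 + i" "trs \<delta> R u = R - D"
      using att by (auto simp: att_def)
    have "p j \<in> R" "q j \<in> R"
      using pq[OF that(4)] trs_subset[OF \<open>P \<subseteq> R\<close>] by auto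
    with * have "card (trs \<delta> (R - D) (drop j v)) < card (R - D)"
      using pq[OF that(4)] by (subst card_trs_less_iff) auto
    then have "card (trs \<delta> R (u @ drop j v)) < card R - 2"
      using u that(2) by (simp add: card_Diff_subset)
    moreover have "length (u @ drop j v) \<le> 9"
      using u(2) that len by simp
    ultimately show False
      using H[of "u @ drop j v"] by linarith
  qed
  \<comment> \<open>Appending the \<open>5 - i\<close> triples of \<open>v\<close> at times after
    \<open>i\<close> keeps the system skew. The total is at most 6, which leaves
    \<open>i + 1\<close> for \<open>L\<close>.\<close>
  have few: "length L \<le> i + 1"
    if L: "\<forall>(D, p, q) \<in> set L. att (4 + i) D \<and> card D = 2 \<and> p \<notin> D \<and> q \<notin> D"
      and sorted: "sorted_wrt (\<lambda>(D, _) (_, p, q). p \<in> D \<or> q \<in> D) L" and "i < 6" for L i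
  proof -
    define D where "D j = R - trs \<delta> P (take j v)" for j
    have D: "att (4 + j) (D j)" "card (D j) = 2" if "j < 6" for j
    proof -
      have sub: "trs \<delta> P (take j v) \<subseteq> R"
        by (rule trs_subset[OF \<open>P \<subseteq> R\<close>])
      have "trs \<delta> R ([a, a1, a2, c0] @ take j v) = R - D j"
        unfolding trs_append P_def[symmetric] using sub by (auto simp: D_def)
      then show "att (4 + j) (D j)"
        unfolding att_def by (intro conjI exI[of _ "[a, a1, a2, c0] @ take j v"]) (auto simp: D_def)
      have "card (trs \<delta> P (take j v)) = card P"
        using v(2)[of "take j v"] card_trs_le[of P \<delta> "take j v"] that len by simp
      then show "card (D j) = 2"
        using cardP r sub by (simp add: D_def card_Diff_subset)
    qed
    let ?L = "L @ map (\<lambda>j. (D j, p j, q j)) [Suc i..<6]"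
    have "length ?L \<le> (2 + 2) choose 2"
    proof (rule skew_bollobas_pairs)
      fix D' p' q' assume "(D', p', q') \<in> set ?L"
      then show "card D' \<le> 2 \<and> p' \<notin> D' \<and> q' \<notin> D'"
        using L D pq by (fastforce simp: D_def)
    next
      have "p k \<in> D j \<or> q k \<in> D j" if "j < k" "k < 6" for j k
        using att_meets[OF D that] that by simp
      then have "sorted_wrt (\<lambda>(D, _) (_, p, q). p \<in> D \<or> q \<in> D) (map (\<lambda>j. (D j, p j, q j)) [Suc i..<6])"
        by (auto simp: sorted_wrt_iff_nth_less)
      moreover have "\<forall>(D', _) \<in> set L. \<forall>j \<in> {Suc i..<6}. p j \<in> D' \<or> q j \<in> D'"
      proof clarify
        fix D' p' q' j assume "(D', p', q') \<in> set L" "j \<in> {Suc i..<6}" "q j \<notin> D'"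
        then show "p j \<in> D'"
          using att_meets[of i D' j] L by auto
      qed
      ultimately show "sorted_wrt (\<lambda>(D, _) (_, p, q). p \<in> D \<or> q \<in> D) ?L"
        using sorted by (auto simp: sorted_wrt_append)
    qed
    then show ?thesis
      using \<open>i < 6\<close> by (simp add: choose_two)
  qed
  have diff: "\<exists>s. s \<in> D - D'" if "card D = 2" "card D' = 2" "D \<noteq> D'" for D D' :: "'q set"
    using that card_subset_eq[of D' D] by auto
  have avoid: "\<exists>s. s \<notin> D" if "card D = 2" for D :: "'q set"
    using that r card_mono[of D R] by fastforce
  \<comment> \<open>Here and in \<open>att5\<close> and \<open>att6\<close>, excess missing sets are
    ordered with test pairs, possibly degenerate, to form a skew list longer than \<open>few\<close>
    permits.\<close>
  have att4: "D1 = D2" if "att 4 D1" "att 4 D2" "card D1 = 2" "card D2 = 2" for D1 D2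
  proof (rule ccontr)
    assume "D1 \<noteq> D2"
    with diff[OF that(3,4)] avoid[OF that(3)] obtain s t where "s \<in> D1 - D2" "t \<notin> D1"
      by blast
    with few[of "[(D1, t, t), (D2, s, s)]" 0] that show False by auto
  qed
  have att5: "D1 = D2 \<or> D3 = D1 \<or> D3 = D2" if "att 5 D1" "att 5 D2" "att 5 D3"
    "card D1 = 2" "card D2 = 2" "card D3 = 2" for D1 D2 D3
  proof (rule ccontr)
    assume "\<not> ?thesis"
    with diff[OF that(4,6)] diff[OF that(5,6)] diff[OF that(4,5)] avoid[OF that(4)]
    obtain s t u w where "s \<in> D1 - D3" "t \<in> D2 - D3" "u \<in> D1 - D2" "w \<notin> D1"
      by blast
    with few[of "[(D1, w, w), (D2, u, u), (D3, s, t)]" 1] that show False by auto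
  qed
  have att6: False if "att 6 {e, p}" "att 6 {e, q}" "att 6 {e, r}" "att 6 {s, u}"
      "distinct [e, p, q, r]" "{p, q, r} \<subseteq> R" "e \<notin> {s, u}" "s \<noteq> u" for p q r s u
    using few[of "[({e, p}, q, q), ({e, q}, p, p), ({e, r}, p, q), ({s, u}, e, e)]" 2] that by auto
  have att_step: "att (Suc n) D'" if att: "att n D" and "f b ` (R - D) = R - D'" "D' \<subseteq> R" for n D D' b
  proof -
    obtain u where "length u \<le> n" "trs \<delta> R u = R - D"
      using att by (auto simp: att_def)
    then show ?thesis
      using that(2,3) trs_snoc[of R u b] unfolding att_def by (intro conjI exI[of _ "u @ [b]"]) auto
  qed
  have att_x: "att 2 {x}"
    unfolding att_def using x by (intro conjI exI[of _ "[a, a1]"]) auto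
  have att_mono: "att m D" if "att n D" "n \<le> m" for n m D
    using that by (auto simp: att_def intro: order_trans)
  have att_perm: "att (Suc n) (f b ` D)" if "att n D" "b \<notin> C" "D \<subseteq> R" for n D b
    using att_step[OF that(1) perm_image[OF that(2,3)]] that(3) fR by auto
  \<comment> \<open>As \<open>c\<close> identifies \<open>e\<close> with \<open>x\<close>, removing
    \<open>e\<close> does not change the image, and \<open>f c\<close> is injective on the
    rest.\<close>
  have C_diff: "f c ` (R - {e, s}) = R - {e, f c s}" if "c \<in> C" "s \<in> R - {e}" for c s
  proof -
    have "f c ` R = f c ` (R - {e})"
      using C_merge[OF that(1)] x \<open>e \<noteq> x\<close> by (auto simp: image_iff)
    then show ?thesis
      using inj_on_image_set_diff[OF C_inj[of c], of "R - {e}" "{s}"] C_image[OF that(1)] that(2)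
      by (simp add: set_diff_eq) blast
  qed
  have att_C2: "att (Suc n) {e, f c s}" if "att n {e, s}" "s \<in> R - {e}" "c \<in> C" for n s c
    using att_step[OF that(1) C_diff[OF that(3,2)]] e fR that by auto
  have att_C1: "att (Suc n) {e, f c s}" if "att n {s}" "s \<in> R - {e, x}" "c \<in> C" for n s c
  proof (rule att_step[OF that(1)])
    have "f c ` (R - {s}) = f c ` (R - {e, s})"
      using C_merge[OF that(3)] x \<open>e \<noteq> x\<close> that(2) by (auto simp: image_iff)
    then show "f c ` (R - {s}) = R - {e, f c s}"
      using C_diff that by simp
  qed (use e fR that in auto)

  \<comment> \<open>Contradiction from a small closed set\<close>
  have "\<exists>K. e \<in> K \<and> K \<subseteq> R \<and> card K \<le> 3 \<and> (\<forall>b. f b ` K \<subseteq> K)"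
  proof (rule three_state_closed_set[where R = R and e = e and x = x and f = f and C = C
        and ?a1.0 = a1 and ?a2.0 = a2 and ?c0.0 = c0 and att = att])
    show "f c s \<noteq> e" if "c \<in> C" "s \<in> R" for c s
      using C_image[OF that(1)] that(2) by blast
  qed (rule C_inj | fact e x \<open>e \<noteq> x\<close> C_merge perm fR perm_e a1 a2 c0 att_x att_mono att_perm att_C1 att_C2
      att4 att5 att6)+
  then obtain K where K: "e \<in> K" "K \<subseteq> R" "card K \<le> 3" "\<And>b. f b ` K \<subseteq> K"
    by blast
  \<comment> \<open>Permutations map \<open>K\<close> onto itself, and letters of \<open>C\<close>,
    whose image omits \<open>e\<close>, map \<open>K - {e}\<close> onto itself. By injectivity
    nothing enters \<open>K\<close> from outside, so its complement is closed too.\<close>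
  have "f b s \<notin> K" if "s \<in> R - K" for b s
  proof (cases "b \<in> C")
    case True
    have "f b ` (K - {e}) \<subseteq> K - {e}"
      using K C_image[OF True] by blast
    moreover have "inj_on (f b) (K - {e})"
      using inj_on_subset[OF C_inj] K(2) by blast
    ultimately have onto: "f b ` (K - {e}) = K - {e}"
      by (intro endo_inj_surj) auto
    show ?thesis
    proof
      assume "f b s \<in> K"
      moreover have "f b s \<noteq> e"
        using C_image[OF True] that by auto
      ultimately have "f b s \<in> f b ` (K - {e})"
        using onto by simp
      then obtain s' where "s' \<in> K - {e}" "f b s = f b s'"
        by blast
      then show False
        using inj_onD[OF C_inj[of b], of s s'] that K(1,2) by auto
    qed
  next
    case False
    have onto: "f b ` K = K"
      using K inj_on_subset[OF perm[OF False] K(2)] by (intro endo_inj_surj) auto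
    show ?thesis
    proof
      assume "f b s \<in> K"
      then have "f b s \<in> f b ` K"
        using onto by simp
      then obtain s' where "s' \<in> K" "f b s = f b s'"
        by blast
      then show False
        using inj_onD[OF perm[OF False], of s s'] that K(2) by auto
    qed
  qed
  then show False
    using no_disjoint_closed_subsets[of K] K r fR unfolding f_def by fastforce
qed

end

section \<open>Bounds for reset words\<close>

text \<open>The hockey-stick identity after reversing the summation.\<close>

lemma sum_choose_two: "(\<Sum>j = 2..r. (r - j + 2) choose 2) = (r + 1) choose 3"
proof -
  have "(\<Sum>j = 2..r. (r - j + 2) choose 2) = (\<Sum>j = 2..r. (r + 2 - j) choose 2)"
    by (intro sum.cong) (auto simp: Suc_diff_le)
  also have "\<dots> = (\<Sum>j = 2..r. j choose 2)"
    by (rule sum.atLeastAtMost_rev[symmetric])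
  also have "\<dots> = (r + 1) choose 3"
  proof (induction r)
    case (Suc r)
    then show ?case by (cases "r = 0") (simp_all add: numeral_eq_Suc)
  qed simp
  finally show ?thesis .
qed

lemma six_choose_three: "6 * real ((r + 1) choose 3) = real r ^ 3 - real r"
proof (induction r)
  case (Suc r)
  have "2 * ((r + 1) choose 2) = r * (r + 1)"
    by (simp add: choose_two)
  then have "2 * real ((r + 1) choose 2) = real r * (real r + 1)"
    by (metis of_nat_1 of_nat_add of_nat_mult of_nat_numeral)
  moreover have "Suc r + 1 choose 3 = ((r + 1) choose 2) + ((r + 1) choose 3)"
    by (simp add: numeral_eq_Suc)
  ultimately show ?case
    using Suc.IH by (simp add: algebra_simps power3_eq_cube)
qed simp

context synchronizing_on
begin

text \<open>For \<open>r\<close> = 1, 2, 3 the cubic bound equals 0, 1, 4, the squares of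
  \<open>r - 1\<close>.\<close>

lemma reset_word_le_three:
  assumes "R \<noteq> {}" "card R \<le> 3"
  shows "\<exists>v. card (trs \<delta> R v) = 1 \<and> length v \<le> (card R - 1)\<^sup>2"
proof -
  have "card R \<noteq> 0"
    using assms by simp
  with assms(2) consider "card R = 1" | "card R = 2" | "card R = 3"
    by linarith
  then have "(card R + 1) choose 3 = (card R - 1)\<^sup>2"
    by cases (simp_all add: numeral_eq_Suc)
  with short_reset[OF subset_refl assms(1)] show ?thesis
    unfolding sum_choose_two by simp
qed

lemma reset_word_ge_four:
  assumes r: "4 \<le> card R"
  shows "\<exists>v. card (trs \<delta> R v) = 1 \<and> length v + 1 \<le> (card R + 1) choose 3"
proof -
  let ?r = "card R"
  let ?g = "\<lambda>j. (?r - j + 2) choose 2"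
  obtain v where v: "length v \<le> 9" "card (trs \<delta> R v) \<le> ?r - 3"
    using rank_drop_three[OF r] by blast
  have "trs \<delta> R v \<noteq> {}"
    using r by (auto simp: trs_def)
  from short_reset[OF trs_subset[OF subset_refl] this]
  obtain u where u: "card (trs \<delta> (trs \<delta> R v) u) = 1" "length u \<le> sum ?g {2..card (trs \<delta> R v)}"
    by blast
  have "sum ?g {2..card (trs \<delta> R v)} \<le> sum ?g {2..?r - 3}"
    using v(2) by (intro sum_mono2) auto
  \<comment> \<open>The three top ranks contribute 1, 3 and 6; the 9 letters of \<open>v\<close>
    replace these 10.\<close>
  moreover have "sum ?g {2..?r} = sum ?g {2..?r - 3} + 10"
  proof -
    have "{2..?r} = {2..?r - 3} \<union> {?r - 2, ?r - 1, ?r}"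
      using r by auto
    moreover have "sum ?g ({2..?r - 3} \<union> {?r - 2, ?r - 1, ?r})
      = sum ?g {2..?r - 3} + sum ?g {?r - 2, ?r - 1, ?r}"
      using r by (intro sum.union_disjoint) auto
    moreover have "sum ?g {?r - 2, ?r - 1, ?r} = 10"
    proof -
      have "?r - 2 \<noteq> ?r - 1" "?r - 2 \<noteq> ?r" "?r - 1 \<noteq> ?r"
        "?r - (?r - 2) + 2 = 4" "?r - (?r - 1) + 2 = 3" "?r - ?r + 2 = 2"
        using r by linarith+
      then have "sum ?g {?r - 2, ?r - 1, ?r} = (4 choose 2) + ((3 choose 2) + (2 choose 2))"
        by (simp only: sum.insert_if finite.intros insert_iff empty_iff) simp
      then show ?thesis
        by (simp add: choose_two)
    qed
    ultimately show ?thesis by simp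
  qed
  ultimately have "length (v @ u) + 1 \<le> (?r + 1) choose 3"
    using u(2) v(1) unfolding sum_choose_two by simp
  with u(1) show ?thesis
    by (intro exI[of _ "v @ u"]) simp
qed

lemma merge_pair:
  assumes "p \<in> R" "q \<in> R"
  shows "\<exists>v. tr \<delta> p v = tr \<delta> q v \<and> length v \<le> ((card R)\<^sup>2 - card R) div 2"
proof (cases "p = q")
  case True
  then show ?thesis by (intro exI[of _ "[]"]) simp
next
  case False
  then have two: "card {p, q} = 2" by simp
  have "2 \<le> card R"
    using card_mono[of R "{p, q}"] assms two by simp
  then have "card R - 2 + 2 = card R"
    by linarith
  then have "(card R - 2 + 2) choose 2 = ((card R)\<^sup>2 - card R) div 2"
    by (simp only: choose_two power2_eq_square diff_mult_distrib2 mult_1_right)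
  with short_compression[of "{p, q}", unfolded two] assms obtain v
    where v: "card (trs \<delta> {p, q} v) < 2" "length v \<le> ((card R)\<^sup>2 - card R) div 2"
    by auto
  then have "tr \<delta> p v = tr \<delta> q v"
    using card_trs_less_iff[of "{p, q}" \<delta> v] two by auto
  with v(2) show ?thesis by blast
qed

end

section \<open>The automaton of blocks\<close>

text \<open>Adjointness: pairing \<open>g[u]\<close> with \<open>h\<close> amounts to pairing
  \<open>g\<close> with \<open>h\<close> evaluated after reading \<open>u\<close>.\<close>

lemma sum_vec_word:
  "(\<Sum>q\<in>UNIV. vec_word \<delta> g u $ q * h q) = (\<Sum>p\<in>UNIV. g $ p * h (tr \<delta> p u))"
proof -
  have "(\<Sum>q\<in>UNIV. vec_word \<delta> g u $ q * h q)
    = (\<Sum>q\<in>UNIV. \<Sum>p\<in>{p \<in> UNIV. tr \<delta> p u = q}. g $ p * h (tr \<delta> p u))"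
    by (simp add: vec_word_def sum_distrib_right)
  also have "\<dots> = (\<Sum>p\<in>UNIV. g $ p * h (tr \<delta> p u))"
    by (rule sum.group) auto
  finally show ?thesis .
qed

text \<open>A reset word sends every state to one state \<open>t\<close>, so each sink component
  contains \<open>t\<close> and equals the set reachable from it.\<close>

lemma synchronizing_ex1_sink_component:
  fixes \<delta> :: "'q::finite \<Rightarrow> 'a \<Rightarrow> 'q"
  assumes "synchronizing \<delta>"
  shows "\<exists>!S. sink_component \<delta> S"
proof -
  obtain s t where "trs \<delta> UNIV s = {t}"
    using assms card_1_singletonE unfolding synchronizing_def by metis
  then have s: "tr \<delta> q s = t" for q
    by (auto simp: trs_def)
  show ?thesis
  proof (rule ex1I)
    show "sink_component \<delta> (range (tr \<delta> t))"
      unfolding sink_component_def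
    proof (intro conjI ballI allI)
      fix p q assume "q \<in> range (tr \<delta> t)"
      then obtain v where "q = tr \<delta> t v" by auto
      then show "\<exists>w. tr \<delta> p w = q"
        by (intro exI[of _ "s @ v"]) (simp add: s)
    next
      fix q a assume "q \<in> range (tr \<delta> t)"
      then obtain v where "q = tr \<delta> t v" by auto
      then show "\<delta> q a \<in> range (tr \<delta> t)"
        by (intro range_eqI[of _ _ "v @ [a]"]) simp
    qed simp
  next
    fix S assume S: "sink_component \<delta> S"
    then have closed: "tr \<delta> q v \<in> S" if "q \<in> S" for q v
      using tr_closed[of S \<delta> q v] that by (auto simp: sink_component_def)
    obtain q where "q \<in> S"
      using S by (auto simp: sink_component_def)
    then have "t \<in> S"
      using closed[of q s] s by simp
    then show "S = range (tr \<delta> t)"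
      using S closed by (fastforce simp: sink_component_def)
  qed
qed

text \<open>Truncating with \<open>take d\<close> turns every word into a legitimate letter, so no restriction of the
  alphabet is needed.\<close>

definition block :: "('q \<Rightarrow> 'a \<Rightarrow> 'q) \<Rightarrow> nat \<Rightarrow> 'a list \<Rightarrow> 'q \<Rightarrow> 'a list \<Rightarrow> 'q" where
  "block \<delta> d w q u = tr \<delta> q (take d u @ w)"

lemma tr_block: "tr (block \<delta> d w) q v = tr \<delta> q (concat (map (\<lambda>u. take d u @ w) v))"
  by (induction v arbitrary: q) (simp_all add: block_def)

lemma length_concat_block:
  "length (concat (map (\<lambda>u. take d u @ w) v)) \<le> (length w + d) * length v"
  by (induction v) auto

lemma block_synchronizing:
  fixes \<delta> :: "'q::finite \<Rightarrow> 'a::finite \<Rightarrow> 'q"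
  assumes sink: "sink_component \<delta> S" and good: "good_d \<delta> S w d"
  shows "\<exists>v. card (trs (block \<delta> d w) UNIV v) = 1"
proof -
  let ?\<beta> = "block \<delta> d w"
  have closed: "tr \<delta> q u \<in> S" if "q \<in> S" for q u
    using tr_closed[of S \<delta> q u] sink that by (auto simp: sink_component_def)
  have \<beta>_closed: "tr ?\<beta> q v \<in> S" if "q \<in> S" for q v
    using closed[OF that] by (simp add: tr_block)
  obtain v0 where min: "\<And>v. card (trs ?\<beta> S v0) \<le> card (trs ?\<beta> S v)"
    using ex_has_least_nat[of "\<lambda>_. True" _ "\<lambda>v. card (trs ?\<beta> S v)"] by blast
  define T where "T = trs ?\<beta> S v0"
  define k where "k = card T"
  have "T \<noteq> {}" "T \<subseteq> S"
    using sink \<beta>_closed by (auto simp: T_def trs_def sink_component_def)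
  then obtain t where t: "t \<in> T" by blast
  have "k > 0"
    using t by (auto simp: k_def card_gt_0_iff)
  \<comment> \<open>The word \<open>v0 @ u # v0\<close> has rank at least \<open>k\<close> on
    \<open>S\<close> by minimality, so \<open>u # v0\<close> permutes \<open>T\<close>.\<close>
  have hits_once: "card {p \<in> T. tr ?\<beta> p (u # v0) = t} = 1" for u
  proof -
    let ?h = "\<lambda>p. tr ?\<beta> p (u # v0)"
    have "trs ?\<beta> T (u # v0) = trs ?\<beta> S (v0 @ u # v0)"
      by (simp only: T_def trs_append)
    then have "k \<le> card (?h ` T)"
      using min[of "v0 @ u # v0"] by (simp only: trs_def k_def T_def)
    moreover have "?h ` T \<subseteq> T"
    proof
      fix q assume "q \<in> ?h ` T"
      then obtain p where "p \<in> T" "q = tr ?\<beta> (tr ?\<beta> p [u]) v0" by auto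
      then show "q \<in> T"
        using \<beta>_closed[of p "[u]"] \<open>T \<subseteq> S\<close> by (auto simp: T_def trs_def)
    qed
    ultimately have onto: "?h ` T = T" and "card (?h ` T) = card T"
      using card_seteq[of T "?h ` T"] by (auto simp: k_def)
    then have "inj_on ?h T"
      by (intro eq_card_imp_inj_on) auto
    moreover obtain p where "p \<in> T" "?h p = t"
      using subsetD[OF equalityD2[OF onto] t] by (elim imageE) simp
    ultimately have "{p \<in> T. ?h p = t} = {p}"
      by (auto simp: inj_on_def)
    then show ?thesis by simp
  qed
  define g :: "real^'q" where "g = (\<chi> q. if q \<in> T then 1 / k else 0)"
  have "g \<in> V_sub S"
  proof -
    have "g = (\<Sum>q\<in>T. (1 / k) *\<^sub>R axis q 1)"
      by (simp add: g_def vec_eq_iff axis_def if_distrib[of "\<lambda>x. _ * x"] cong: if_cong)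
    also have "\<dots> \<in> V_sub S"
      unfolding V_sub_def using \<open>T \<subseteq> S\<close> by (intro span_sum span_scale span_base) auto
    finally show ?thesis .
  qed
  have sum_g: "(\<Sum>q\<in>UNIV. g $ q * h q) = (\<Sum>q\<in>T. h q) / k" for h
    by (simp add: g_def sum.If_cases if_distrib[of "\<lambda>x. x * _"] sum_divide_distrib cong: if_cong)
  have "stochastic g"
    using sum_g[of "\<lambda>_. 1"] \<open>T \<noteq> {}\<close> by (simp add: stochastic_def g_def k_def)
  define ind where "ind q = (if tr ?\<beta> (tr \<delta> q w) v0 = t then 1 else (0::real))" for q
  define x :: "real^'q" where "x = (\<chi> q. ind q - 1 / k)"
  have orth: "vec_word \<delta> g u \<bullet> x = 0" if "u \<in> words_upto d" for u
  proof -
    have "ind (tr \<delta> p u) = (if tr ?\<beta> p (u # v0) = t then 1 else 0)" for p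
      using that by (simp add: ind_def block_def words_upto_def)
    then have "(\<Sum>p\<in>T. ind (tr \<delta> p u)) = card {p \<in> T. tr ?\<beta> p (u # v0) = t}"
      by (simp add: sum.If_cases Int_def)
    then have "(\<Sum>p\<in>T. ind (tr \<delta> p u)) = 1"
      unfolding hits_once by simp
    moreover have "vec_word \<delta> g u \<bullet> x = (\<Sum>q\<in>UNIV. vec_word \<delta> g u $ q * (ind q - 1 / k))"
      by (simp add: inner_vec_def x_def)
    ultimately show ?thesis
      using \<open>k > 0\<close> unfolding sum_vec_word sum_g by (simp add: sum_subtractf k_def)
  qed
  \<comment> \<open>By completeness \<open>x\<close> is orthogonal to \<open>axis s 1\<close>, so
    \<open>ind s = 1 / k\<close>; but \<open>ind s\<close> is 0 or 1.\<close>
  have "k = 1"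
  proof -
    obtain s where "s \<in> S" using \<open>T \<noteq> {}\<close> \<open>T \<subseteq> S\<close> by blast
    then have "axis s 1 \<in> span (vec_word \<delta> g ` words_upto d)"
      using good \<open>g \<in> V_sub S\<close> \<open>stochastic g\<close>
      by (auto simp: good_d_def complete_for_def V_sub_def intro: span_base)
    then have "axis s 1 \<bullet> x = 0"
    proof (induction rule: span_induct)
      show "subspace {v. v \<bullet> x = 0}"
        by (auto simp: subspace_def inner_left_distrib)
    qed (use orth in auto)
    then have "ind s = 1 / k"
      by (simp add: inner_axis' x_def)
    then show "k = 1"
      using \<open>k > 0\<close> by (auto simp: ind_def split: if_splits)
  qed
  \<comment> \<open>States are driven into \<open>S\<close> one at a time; \<open>S\<close> is
    closed, so those already inside stay there.\<close>
  have "\<exists>v. trs ?\<beta> P v \<subseteq> S" if "finite P" for P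
    using that
  proof (induction P)
    case (insert q P)
    then obtain v where v: "trs ?\<beta> P v \<subseteq> S" by blast
    obtain u where u: "u \<in> words_upto d" "tr \<delta> (tr ?\<beta> q v) u \<in> S"
      using good unfolding good_d_def by blast
    then have "tr ?\<beta> q (v @ [u]) \<in> S"
      using closed[OF u(2)] by (simp add: block_def words_upto_def)
    moreover have "trs ?\<beta> P (v @ [u]) \<subseteq> S"
      using v \<beta>_closed[of _ "[u]"] by (auto simp: trs_def)
    ultimately have "trs ?\<beta> (insert q P) (v @ [u]) \<subseteq> S"
      by (simp add: trs_def)
    then show ?case by blast
  qed (simp add: trs_def)
  then obtain v where "trs ?\<beta> UNIV v \<subseteq> S" by (meson finite)
  then have "trs ?\<beta> UNIV (v @ v0) \<subseteq> T"
    by (simp add: T_def trs_mono)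
  then have "card (trs ?\<beta> UNIV (v @ v0)) \<le> 1"
    using card_mono[of T] \<open>k = 1\<close> by (metis finite k_def)
  moreover have "card (trs ?\<beta> UNIV (v @ v0)) \<noteq> 0"
    by (simp add: trs_def)
  ultimately show ?thesis
    by (intro exI[of _ "v @ v0"]) linarith
qed

theorem theorem2:
  fixes \<delta> :: "'q::finite \<Rightarrow> 'a::finite \<Rightarrow> 'q"
  assumes "synchronizing \<delta>"
  shows "(\<exists>!S. sink_component \<delta> S) \<and>
    (\<forall>S. sink_component \<delta> S \<longrightarrow>
      (\<forall>(w::'a list) d. 
         0 < d \<and> d < CARD('q) \<and> good_d \<delta> S w d \<and>
         (\<forall>d'. 0 < d' \<and> d' < d \<longrightarrow> \<not> good_d \<delta> S w d') \<longrightarrow>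
         (let r = card (trs \<delta> UNIV w) in
           (r \<ge> 4 \<longrightarrow> real (reset_threshold \<delta>)
               \<le> (real (length w) + real d) * ((real r ^ 3 - real r) / 6) - real d) \<and>
           (r \<le> 3 \<longrightarrow> reset_threshold \<delta> \<le> length w + (length w + d) * (r - 1)^2) \<and>
           (\<forall>p q. \<exists>u. length u \<le> length w + (length w + d) * ((r^2 - r) div 2)
                      \<and> tr \<delta> p u = tr \<delta> q u))))"
proof (intro conjI allI impI)
  show "\<exists>!S. sink_component \<delta> S"
    by (rule synchronizing_ex1_sink_component[OF assms])
next
  fix S and w :: "'a list" and d
  assume sink: "sink_component \<delta> S"
    and d: "0 < d \<and> d < CARD('q) \<and> good_d \<delta> S w d \<and>
         (\<forall>d'. 0 < d' \<and> d' < d \<longrightarrow> \<not> good_d \<delta> S w d')"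
  define R where "R = trs \<delta> UNIV w"
  define r where "r = card R"
  let ?\<beta> = "block \<delta> d w"
  let ?flat = "\<lambda>v. concat (map (\<lambda>u. take d u @ w) v)"
  have "R \<noteq> {}" by (simp add: R_def trs_def)
  \<comment> \<open>Every block ends in \<open>w\<close>, so block letters map all states into
    \<open>R\<close>.\<close>
  interpret synchronizing_on ?\<beta> R
  proof
    show "?\<beta> q a \<in> R" for q a
      by (simp add: block_def R_def trs_def)
    obtain v where v: "card (trs ?\<beta> UNIV v) = 1"
      using block_synchronizing[OF sink] d by blast
    have "card (trs ?\<beta> R v) \<le> 1"
      using card_mono[of "trs ?\<beta> UNIV v" "trs ?\<beta> R v"] v by (simp add: trs_mono)
    moreover have "card (trs ?\<beta> R v) \<noteq> 0"
      using \<open>R \<noteq> {}\<close> by (simp add: trs_def)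
    ultimately show "\<exists>v. card (trs ?\<beta> R v) = 1"
      by (intro exI[of _ v]) linarith
  qed
  \<comment> \<open>One initial \<open>w\<close> leads into \<open>R\<close>; each block letter then
    costs at most \<open>length w + d\<close>.\<close>
  have reset: "reset_threshold \<delta> \<le> length w + (length w + d) * m"
    if "card (trs ?\<beta> R v) = 1" "length v \<le> m" for v m
  proof -
    have "card (trs \<delta> UNIV (w @ ?flat v)) = 1"
      using that(1) by (simp add: R_def trs_def tr_block image_image)
    then have "reset_threshold \<delta> \<le> length (w @ ?flat v)"
      unfolding reset_threshold_def by (intro Least_le) blast
    also have "\<dots> \<le> length w + (length w + d) * length v"
      using length_concat_block[of d w v] by simp
    also have "\<dots> \<le> length w + (length w + d) * m"
      using that(2) by simp
    finally show ?thesis .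
  qed
  have "real (reset_threshold \<delta>)
      \<le> (real (length w) + real d) * ((real r ^ 3 - real r) / 6) - real d" if r4: "r \<ge> 4"
  proof -
    obtain v where v: "card (trs ?\<beta> R v) = 1" "length v + 1 \<le> (r + 1) choose 3"
      using reset_word_ge_four r4 unfolding r_def by blast
    have "real (reset_threshold \<delta>) \<le> real (length w + (length w + d) * length v)"
      using reset[OF v(1) order_refl] of_nat_mono by blast
    \<comment> \<open>The letter saved in \<open>reset_word_ge_four\<close> absorbs the initial
      \<open>w\<close> and leaves the gain \<open>d\<close>.\<close>
    also have "\<dots> = (real (length w) + real d) * (real (length v) + 1) - real d"
      by (simp add: algebra_simps)
    also have "\<dots> \<le> (real (length w) + real d) * real ((r + 1) choose 3) - real d"
      using v(2) by (intro diff_right_mono mult_left_mono) linarith+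
    also have "real ((r + 1) choose 3) = (real r ^ 3 - real r) / 6"
      using six_choose_three[of r] by simp
    finally show ?thesis .
  qed
  moreover have "reset_threshold \<delta> \<le> length w + (length w + d) * (r - 1)^2" if "r \<le> 3"
    using reset_word_le_three[OF \<open>R \<noteq> {}\<close>] reset that unfolding r_def by blast
  moreover have "\<exists>u. length u \<le> length w + (length w + d) * ((r^2 - r) div 2) \<and> tr \<delta> p u = tr \<delta> q u"
    for p q
  proof -
    have "tr \<delta> p w \<in> R" "tr \<delta> q w \<in> R"
      by (simp_all add: R_def trs_def)
    from merge_pair[OF this] obtain v
      where v: "tr ?\<beta> (tr \<delta> p w) v = tr ?\<beta> (tr \<delta> q w) v" "length v \<le> (r^2 - r) div 2"
      unfolding r_def by blast
    have "length (?flat v) \<le> (length w + d) * ((r^2 - r) div 2)"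
      using length_concat_block[of d w v] v(2) by (meson le_trans mult_le_mono2)
    with v(1) show ?thesis
      by (intro exI[of _ "w @ ?flat v"]) (simp add: tr_block)
  qed
  ultimately show "let r = card (trs \<delta> UNIV w) in
           (r \<ge> 4 \<longrightarrow> real (reset_threshold \<delta>)
               \<le> (real (length w) + real d) * ((real r ^ 3 - real r) / 6) - real d) \<and>
           (r \<le> 3 \<longrightarrow> reset_threshold \<delta> \<le> length w + (length w + d) * (r - 1)^2) \<and>
           (\<forall>p q. \<exists>u. length u \<le> length w + (length w + d) * ((r^2 - r) div 2)
                      \<and> tr \<delta> p u = tr \<delta> q u)"
    unfolding Let_def R_def[symmetric] r_def[symmetric] by blast
qed

end
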